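(* Let $a,b\ge1$ and let $T$ be a tabloid of rectangular shape $\langle a^b\rangle$ (that is, $b$ rows each of length $a$). For $i=1,\dots,b$, denote the entries in row $i$ of $T$ by $\{\overline{T_{i,1}},\dots,\overline{T_{i,a}}\}$. Then the affine evacuation $e(T)$ is the tabloid whose $i$th row contains the entries $\{\overline{ab+1-T_{b+1-i,1}},\dots,\overline{ab+1-T_{b+1-i,a}}\}$ for all $i$. That is, $e(T)$ is obtained from $T$ by turning it upside down and replacing entries according to the rule $\overline j\mapsto\overline{ab+1-j}$.
   Context: **Tabloids.** $[\overline n]$ is the set of residue classes of integers modulo $n$ (here $n=ab$); $\overline i$ is the class of $i$. A tabloid of shape $\lambda\vdash n$ is a bijective filling of the Young diagram of $\lambda$ with the elements of $[\overline n]$, up to reordering entries within rows. $\mathrm{Des}(T)$ is the set of $\overline i$ such that $\overline{i+1}$ lies in a strictly lower row of $T$ than $\overline i$. Tabloids $T,T'$ are related by a Knuth move if $T'$ is obtained from $T$ by exchanging two elements $\overline i$ and $\overline{i+1}$, and $\mathrm{Des}(T)$, $\mathrm{Des}(T')$ are incomparable under inclusion. The Knuth move has type $\overline i$ if $\overline i$ is in exactly one of $\mathrm{Des}(T),\mathrm{Des}(T')$ and $\overline{i+1}$ is in exactly the other one. $\mathcal A_\lambda$ is the graph on tabloids of shape $\lambda$ whose edges are Knuth moves. $\mathrm{RRSS}(\lambda,\overline k)$ is the tabloid with first row $\overline k,\overline{k-1},\dots,\overline{k-\lambda_1+1}$, second row $\overline{k-\lambda_1},\dots,\overline{k-\lambda_1-\lambda_2+1}$,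 and so on. **Affine evacuation.** For each $\lambda\vdash n$ there is a unique automorphism $e$ of $\mathcal A_\lambda$ such that $e(\mathrm{RRSS}(\lambda,\overline k))=\mathrm{RRSS}(\lambda,\overline{n-k})$ for all $\overline k\in[\overline n]$ and such that $e$ sends every edge that is a Knuth move of type $\overline k$ to an edge that is a Knuth move of type $\overline{n-k-1}$. This $e$ is called affine evacuation. *)

theory Defs
  imports Main "HOL-Library.FuncSet" "HOL-Combinatorics.Transposition"
begin

text \<open>
  A residue class modulo \<open>n\<close> is represented by its canonical representative in
  \<open>{0..<int n}\<close>, so \<open>res n i\<close> is the class of the integer \<open>i\<close>.
  Shapes are lists of row lengths, top row first.  Rows are indexed from \<open>0\<close>, and a
  larger row index means a strictly lower row.
\<close>

definition res :: "nat \<Rightarrow> int \<Rightarrow> int" where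
  "res n i = i mod int n"

definition residue_classes :: "nat \<Rightarrow> int set" where
  "residue_classes n = range (res n)"

definition diagram :: "nat list \<Rightarrow> (nat \<times> nat) set" where
  "diagram lam = {(r, c). r < length lam \<and> c < lam ! r}"

definition filling :: "nat list \<Rightarrow> (nat \<times> nat \<Rightarrow> int) \<Rightarrow> bool" where
  "filling lam f \<longleftrightarrow> bij_betw f (diagram lam) (residue_classes (sum_list lam))"

text \<open>
  Two fillings agree up to reordering entries within rows iff they have the same row sets,
  so a tabloid is encoded as the list of the row sets of a filling.
\<close>

type_synonym tabloid = "int set list"

definition row_sets :: "nat list \<Rightarrow> (nat \<times> nat \<Rightarrow> int) \<Rightarrow> tabloid" where
  "row_sets lam f = map (\<lambda>r. {f (r, c) | c. c < lam ! r}) [0..<length lam]"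

definition tabloids :: "nat list \<Rightarrow> tabloid set" where
  "tabloids lam = {row_sets lam f | f. filling lam f}"

definition Des :: "nat \<Rightarrow> tabloid \<Rightarrow> int set" where
  "Des n T = {i \<in> residue_classes n.
     \<exists>p q. p < q \<and> q < length T \<and> i \<in> T ! p \<and> res n (i + 1) \<in> T ! q}"

definition exchange :: "nat \<Rightarrow> int \<Rightarrow> tabloid \<Rightarrow> tabloid" where
  "exchange n i T = map (\<lambda>R. transpose (res n i) (res n (i + 1)) ` R) T"

definition knuth_move :: "nat \<Rightarrow> tabloid \<Rightarrow> tabloid \<Rightarrow> bool" where
  "knuth_move n T T' \<longleftrightarrow>
     (\<exists>i. T' = exchange n i T) \<and> \<not> Des n T \<subseteq> Des n T' \<and> \<not> Des n T' \<subseteq> Des n T"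

text \<open>A single Knuth move may have more than one type.\<close>

definition knuth_move_of_type :: "nat \<Rightarrow> int \<Rightarrow> tabloid \<Rightarrow> tabloid \<Rightarrow> bool" where
  "knuth_move_of_type n i T T' \<longleftrightarrow> knuth_move n T T' \<and>
     (res n i \<in> Des n T - Des n T' \<and> res n (i + 1) \<in> Des n T' - Des n T \<or>
      res n i \<in> Des n T' - Des n T \<and> res n (i + 1) \<in> Des n T - Des n T')"

definition RRSS :: "nat list \<Rightarrow> int \<Rightarrow> tabloid" where
  "RRSS lam k =
     row_sets lam (\<lambda>(r, c). res (sum_list lam) (k - int (sum_list (take r lam)) - int c))"

definition knuth_automorphism :: "nat list \<Rightarrow> (tabloid \<Rightarrow> tabloid) \<Rightarrow> bool" where
  "knuth_automorphism lam e \<longleftrightarrow> bij_betw e (tabloids lam) (tabloids lam) \<and>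
     (\<forall>T \<in> tabloids lam. \<forall>T' \<in> tabloids lam.
        knuth_move (sum_list lam) T T' \<longleftrightarrow> knuth_move (sum_list lam) (e T) (e T'))"

text \<open>
  Automorphisms are required to be \<open>extensional\<close>, i.e. \<open>undefined\<close> outside the vertex set,
  so that uniqueness as a map on vertices is uniqueness as a HOL function.
\<close>

definition is_affine_evacuation :: "nat list \<Rightarrow> (tabloid \<Rightarrow> tabloid) \<Rightarrow> bool" where
  "is_affine_evacuation lam e \<longleftrightarrow>
     e \<in> extensional (tabloids lam) \<and>
     knuth_automorphism lam e \<and>
     (\<forall>k. e (RRSS lam k) = RRSS lam (int (sum_list lam) - k)) \<and>
     (\<forall>k. \<forall>T \<in> tabloids lam. \<forall>T' \<in> tabloids lam.
        knuth_move_of_type (sum_list lam) k T T' \<longrightarrow>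
        knuth_move_of_type (sum_list lam) (int (sum_list lam) - k - 1) (e T) (e T'))"

definition affine_evacuation :: "nat list \<Rightarrow> tabloid \<Rightarrow> tabloid" where
  "affine_evacuation lam = (THE e. is_affine_evacuation lam e)"

end

theory Submission
  imports Defs "HOL-Library.Multiset"
begin

text \<open>
  A tabloid with \<open>n\<close> entries is the same as a word written on a circle with \<open>n\<close> positions: position
  \<open>i\<close> carries the index of the row that contains the class of \<open>i\<close>.  In this language \<open>i\<close> is a
  descent iff the letter at \<open>i\<close> is smaller than the next one, the Knuth moves include the Knuth
  relations of the plactic monoid applied to the linear words obtained by cutting the circle anywhere,
  and the row superstandard tabloids are the words that are weakly decreasing for a suitable cut.

  Affine evacuation is defined as the unique automorphism with two properties, so the proof shows that
  turning upside down and reflecting the entries has both of them on rectangles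
  (\<open>upside_down_is_affine_evacuation\<close>), and that at most one map has them
  (\<open>affine_evacuation_unique\<close>, for every shape).

  The first part is a computation: the map negates descents and the positions of exchanges, and
  it sends one row superstandard tabloid to another.

  The second part rests on two facts.  First, the type of a Knuth move determines its other endpoint
  (\<open>typed_move_unique\<close>), so an automorphism with prescribed types is determined on a
  connected component by its value at one vertex.  Second, every component contains a row
  superstandard tabloid (\<open>connected_to_RRSS\<close>).  For this, keep the circular word in the form
  \<open>V @ R\<close> with \<open>R\<close> weakly decreasing, and repeatedly insert the first letter of \<open>V\<close> into \<open>R\<close>.  On
  the circle this letter gets to the end of \<open>R\<close> by a mere turn of the cut.  Schensted insertion
  either lengthens \<open>R\<close> or gives back a strictly smaller letter to \<open>V\<close>, so the process ends, and it
  ends with a sorted circular word.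
\<close>

section \<open>Plactic moves on words\<close>

text \<open>
  The letters of a word are row indices.  These are the Knuth relations of the plactic
  monoid for the reversed order of the letters, so the sorted words of the theory are the
  weakly decreasing ones.  Each relation is listed in one direction only, the one in which
  row insertion uses it.
\<close>

inductive plactic_step :: "nat list \<Rightarrow> nat list \<Rightarrow> bool" where
  left_witness: "x \<le> y \<Longrightarrow> y < z \<Longrightarrow> plactic_step (U @ [y, x, z] @ V) (U @ [y, z, x] @ V)"
| right_witness: "x < y \<Longrightarrow> y \<le> z \<Longrightarrow> plactic_step (U @ [z, x, y] @ V) (U @ [x, z, y] @ V)"

lemma plactic_step_context:
  assumes "plactic_step W W'"
  shows "plactic_step (A @ W @ B) (A @ W' @ B)"
  using assms
proof cases
  case (left_witness x y z U V)
  then show ?thesis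
    using plactic_step.left_witness[of x y z "A @ U" "V @ B"] by simp
next
  case (right_witness x y z U V)
  then show ?thesis
    using plactic_step.right_witness[of x y z "A @ U" "V @ B"] by simp
qed

lemma plactic_steps_context:
  assumes "plactic_step\<^sup>*\<^sup>* W W'"
  shows "plactic_step\<^sup>*\<^sup>* (A @ W @ B) (A @ W' @ B)"
  using assms
  by (induction rule: rtranclp_induct)
    (auto intro: rtranclp.rtrancl_into_rtrancl plactic_step_context)

lemma plactic_step_mset: "plactic_step W W' \<Longrightarrow> mset W' = mset W"
  by (induction rule: plactic_step.induct) auto

lemma plactic_steps_mset: "plactic_step\<^sup>*\<^sup>* W W' \<Longrightarrow> mset W' = mset W"
  by (induction rule: rtranclp_induct) (auto dest: plactic_step_mset)

text \<open>
  First half of a row insertion.  The letter \<open>x\<close> is larger than all of \<open>y # B\<close>, so at each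
  transposition with a letter \<open>q\<close> of \<open>B\<close> the letter \<open>p\<close> to the left of \<open>q\<close> satisfies
  \<open>q \<le> p < x\<close> and serves as the witness.  At \<open>y\<close> itself no such witness is left.
\<close>

lemma large_letter_moves_left:
  assumes "sorted_wrt (\<ge>) (y # B)" "\<forall>q \<in> set (y # B). q < x"
  shows "plactic_step\<^sup>*\<^sup>* (y # B @ [x]) (y # x # B)"
  using assms
proof (induction B rule: rev_induct)
  case Nil
  then show ?case by simp
next
  case (snoc q B)
  obtain C p where C: "y # B = C @ [p]"
    by (metis append_butlast_last_id list.distinct(1))
  from snoc.prems(1) have "sorted_wrt (\<ge>) ((C @ [p]) @ [q])"
    by (metis C append_Cons)
  then have "q \<le> p" by (simp add: sorted_wrt_append)
  moreover have "p < x"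
    using snoc.prems(2) C by (metis Un_iff append_Cons last_in_set last_snoc set_append snoc_eq_iff_butlast)
  ultimately have "plactic_step (C @ [p, q, x] @ []) (C @ [p, x, q] @ [])"
    by (rule plactic_step.left_witness)
  then have "plactic_step (y # (B @ [q]) @ [x]) ((y # B) @ [x, q])"
    using C by simp (metis append_Cons append.assoc C append_Nil)
  moreover have "plactic_step\<^sup>*\<^sup>* ([] @ (y # B @ [x]) @ [q]) ([] @ (y # x # B) @ [q])"
    using snoc by (intro plactic_steps_context snoc.IH) (auto simp: sorted_wrt_append)
  ultimately show ?case
    by (metis append.left_neutral append.assoc append_Cons converse_rtranclp_into_rtranclp)
qed

text \<open>
  Second half of a row insertion.  The bumped letter \<open>y\<close> passes to the left through the letters
  that are at least \<open>x\<close>.  The witness for passing \<open>z\<close> is the letter on the right of \<open>y\<close>: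
  it is \<open>x\<close> at the start and afterwards the letter passed last.
\<close>

lemma small_letter_moves_left:
  assumes "sorted_wrt (\<ge>) A" "\<forall>z \<in> set A. x \<le> z" "y < x"
  shows "plactic_step\<^sup>*\<^sup>* (A @ [y, x]) (y # A @ [x])"
  using assms
proof (induction A arbitrary: x rule: rev_induct)
  case Nil
  then show ?case by simp
next
  case (snoc z A)
  have "plactic_step (A @ [z, y, x] @ []) (A @ [y, z, x] @ [])"
    using snoc.prems by (intro plactic_step.right_witness) auto
  moreover have "plactic_step\<^sup>*\<^sup>* ([] @ (A @ [y, z]) @ [x]) ([] @ (y # A @ [z]) @ [x])"
    using snoc.prems by (intro plactic_steps_context snoc.IH) (auto simp: sorted_wrt_append)
  ultimately show ?case
    by (auto intro: converse_rtranclp_into_rtranclp)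
qed

text \<open>
  Schensted row insertion, as a chain of Knuth relations: \<open>x\<close> bumps the first letter \<open>y\<close> of \<open>R\<close>
  that is smaller than \<open>x\<close>.  For the termination of the sorting below it matters only that the
  letter handed back on the left is strictly smaller than the inserted one.
\<close>

lemma row_insertion:
  assumes R: "sorted_wrt (\<ge>) R" and not_appendable: "\<not> sorted_wrt (\<ge>) (R @ [x])"
  obtains y R' where "plactic_step\<^sup>*\<^sup>* (R @ [x]) (y # R')" "sorted_wrt (\<ge>) R'" "y < x"
proof -
  define A where "A = takeWhile (\<lambda>z. x \<le> z) R"
  define D where "D = dropWhile (\<lambda>z. x \<le> z) R"
  have RAD: "R = A @ D" by (simp add: A_def D_def)
  have A: "\<forall>z \<in> set A. x \<le> z" by (auto simp: A_def dest: set_takeWhileD)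
  have "D \<noteq> []"
    using R not_appendable A RAD by (auto simp: sorted_wrt_append)
  then obtain y B where D: "D = y # B" by (cases D) auto
  then have y: "y < x" by (metis D_def dropWhile_eq_Cons_conv not_le)
  have sAD: "sorted_wrt (\<ge>) A" "sorted_wrt (\<ge>) (y # B)" "\<forall>z \<in> set A. \<forall>q \<in> set (y # B). q \<le> z"
    using R unfolding RAD D by (auto simp: sorted_wrt_append)
  have "plactic_step\<^sup>*\<^sup>* (A @ (y # B @ [x]) @ []) (A @ (y # x # B) @ [])"
    using sAD y by (intro plactic_steps_context large_letter_moves_left) auto
  moreover have "plactic_step\<^sup>*\<^sup>* ([] @ (A @ [y, x]) @ B) ([] @ (y # A @ [x]) @ B)"
    using sAD A y by (intro plactic_steps_context small_letter_moves_left) auto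
  ultimately have "plactic_step\<^sup>*\<^sup>* (R @ [x]) (y # (A @ [x] @ B))"
    by (simp add: RAD D)
  moreover have "sorted_wrt (\<ge>) (A @ [x] @ B)"
    using sAD A y by (auto simp: sorted_wrt_append)
  ultimately show thesis using that y by blast
qed

section \<open>Tabloids as functions on residue classes\<close>

definition tabloid_of_rows :: "nat \<Rightarrow> nat \<Rightarrow> (int \<Rightarrow> nat) \<Rightarrow> tabloid" where
  "tabloid_of_rows n b w = map (\<lambda>r. {x \<in> residue_classes n. w x = r}) [0..<b]"

lemma residue_classes_eq: "n > 0 \<Longrightarrow> residue_classes n = {0..<int n}"
proof -
  assume "n > 0"
  then have "x \<in> range (res n)" if "x \<in> {0..<int n}" for x
    using that by (intro range_eqI[of _ _ x]) (simp add: res_def)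
  with \<open>n > 0\<close> show ?thesis by (auto simp: residue_classes_def res_def)
qed

lemma res_in_residue_classes [simp]: "res n i \<in> residue_classes n"
  by (simp add: residue_classes_def)

lemma res_res_add [simp]: "res n (res n i + j) = res n (i + j)"
  by (simp add: res_def mod_simps)

lemma res_of_residue [simp]: "x \<in> residue_classes n \<Longrightarrow> res n x = x"
  by (auto simp: residue_classes_def res_def)

lemma reflect_twice:
  assumes "x \<in> residue_classes n"
  shows "res n (c - res n (c - x)) = x"
proof -
  have "res n (c - res n (c - x)) = res n x"
    by (simp add: res_def mod_simps)
  with assms show ?thesis by simp
qed

lemma tabloid_of_rows_cong:
  assumes "\<And>x. x \<in> residue_classes n \<Longrightarrow> w x = w' x"
  shows "tabloid_of_rows n b w = tabloid_of_rows n b w'"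
  using assms by (auto simp: tabloid_of_rows_def)

lemma Des_tabloid_of_rows:
  assumes "\<forall>x \<in> residue_classes n. w x < b"
  shows "Des n (tabloid_of_rows n b w) = {i \<in> residue_classes n. w i < w (res n (i + 1))}"
proof -
  let ?T = "tabloid_of_rows n b w"
  have nth: "x \<in> ?T ! r \<longleftrightarrow> x \<in> residue_classes n \<and> w x = r" if "r < b" for x r
    using that by (simp add: tabloid_of_rows_def)
  have len: "length ?T = b" by (simp add: tabloid_of_rows_def)
  have "(\<exists>p q. p < q \<and> q < length ?T \<and> i \<in> ?T ! p \<and> res n (i + 1) \<in> ?T ! q) \<longleftrightarrow>
      w i < w (res n (i + 1))" if "i \<in> residue_classes n" for i
  proof
    assume "\<exists>p q. p < q \<and> q < length ?T \<and> i \<in> ?T ! p \<and> res n (i + 1) \<in> ?T ! q"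
    then obtain p q where "p < q" "q < b" "i \<in> ?T ! p" "res n (i + 1) \<in> ?T ! q"
      unfolding len by blast
    then show "w i < w (res n (i + 1))" using nth[of p i] nth[of q "res n (i + 1)"] by simp
  next
    assume less: "w i < w (res n (i + 1))"
    have "w i < b" "w (res n (i + 1)) < b" using assms that by auto
    then show "\<exists>p q. p < q \<and> q < length ?T \<and> i \<in> ?T ! p \<and> res n (i + 1) \<in> ?T ! q"
      using less that unfolding len
      by (intro exI[of _ "w i"] exI[of _ "w (res n (i + 1))"]) (simp add: nth)
  qed
  then show ?thesis by (auto simp: Des_def)
qed

lemma exchange_tabloid_of_rows:
  "exchange n i (tabloid_of_rows n b w) =
     tabloid_of_rows n b (w \<circ> transpose (res n i) (res n (i + 1)))"
proof -
  let ?t = "transpose (res n i) (res n (i + 1))"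
  have t: "?t x \<in> residue_classes n" if "x \<in> residue_classes n" for x
    using that by (simp add: transpose_def)
  have "?t ` {x \<in> residue_classes n. w x = r} = {x \<in> residue_classes n. (w \<circ> ?t) x = r}" for r
  proof (intro equalityI subsetI)
    fix x assume "x \<in> {x \<in> residue_classes n. (w \<circ> ?t) x = r}"
    then show "x \<in> ?t ` {x \<in> residue_classes n. w x = r}"
      using t by (intro image_eqI[of _ _ "?t x"]) auto
  qed (use t in auto)
  then show ?thesis by (simp add: exchange_def tabloid_of_rows_def)
qed

lemma diagram_eq_Sigma: "diagram lam = (SIGMA r:{..<length lam}. {..<lam ! r})"
  by (auto simp: diagram_def)

text \<open>
  Modulo \<open>0\<close> there are infinitely many residue classes, so the empty diagram has no filling.
\<close>

lemma tabloids_size_pos: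
  assumes "T \<in> tabloids lam"
  shows "sum_list lam > 0"
proof (rule ccontr)
  assume "\<not> sum_list lam > 0"
  then have "sum_list lam = 0" by simp
  moreover obtain f where "filling lam f"
    using assms by (auto simp: tabloids_def)
  ultimately have "bij_betw f (diagram lam) (range (\<lambda>i::int. i))"
    by (simp only: filling_def residue_classes_def res_def[abs_def]) simp
  moreover have "finite (diagram lam)" by (simp add: diagram_eq_Sigma)
  ultimately show False using bij_betw_finite by fastforce
qed

text \<open>
  The shape is recorded as a multiset of row indices, because Knuth moves and rotations permute the
  letters of a word and so preserve this multiset.
\<close>

lemma tabloid_row_function:
  assumes "T \<in> tabloids lam"
  obtains w where "T = tabloid_of_rows (sum_list lam) (length lam) w"
    and "\<forall>x \<in> residue_classes (sum_list lam). w x < length lam"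
    and "image_mset w (mset_set (residue_classes (sum_list lam))) =
         image_mset fst (mset_set (diagram lam))"
proof -
  let ?R = "residue_classes (sum_list lam)"
  from assms obtain f where T: "T = row_sets lam f" and f: "bij_betw f (diagram lam) ?R"
    by (auto simp: tabloids_def filling_def)
  define w where "w = fst \<circ> inv_into (diagram lam) f"
  have wf: "w (f p) = fst p" if "p \<in> diagram lam" for p
    using f that by (simp add: w_def bij_betw_def inv_into_f_f)
  have R: "?R = f ` diagram lam" using f by (simp add: bij_betw_def)
  have rows: "{f (r, c) |c. c < lam ! r} = {x \<in> ?R. w x = r}" if "r < length lam" for r
  proof (intro equalityI subsetI)
    fix x assume "x \<in> {f (r, c) |c. c < lam ! r}"
    then obtain c where c: "x = f (r, c)" "c < lam ! r" by blast
    with that have "(r, c) \<in> diagram lam" by (simp add: diagram_def)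
    with c show "x \<in> {x \<in> ?R. w x = r}" using wf[of "(r, c)"] by (simp add: R)
  next
    fix x assume "x \<in> {x \<in> ?R. w x = r}"
    then obtain p where p: "x = f p" "p \<in> diagram lam" "fst p = r"
      using wf by (auto simp: R)
    then show "x \<in> {f (r, c) |c. c < lam ! r}"
      by (cases p) (auto simp: diagram_def)
  qed
  show thesis
  proof
    show "T = tabloid_of_rows (sum_list lam) (length lam) w"
      by (simp add: T row_sets_def tabloid_of_rows_def rows)
    show "\<forall>x \<in> ?R. w x < length lam"
      by (auto simp: R wf) (auto simp: diagram_def)
    have "image_mset w (mset_set ?R) = image_mset w (image_mset f (mset_set (diagram lam)))"
      using f by (simp add: image_mset_mset_set bij_betw_def)
    also have "\<dots> = image_mset (w \<circ> f) (mset_set (diagram lam))"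
      by (simp add: multiset.map_comp)
    also have "\<dots> = image_mset fst (mset_set (diagram lam))"
      by (intro image_mset_cong) (auto simp: wf diagram_eq_Sigma)
    finally show "image_mset w (mset_set ?R) = image_mset fst (mset_set (diagram lam))" .
  qed
qed

lemma exchange_in_tabloids:
  assumes "T \<in> tabloids lam"
  shows "exchange (sum_list lam) i T \<in> tabloids lam"
proof -
  let ?n = "sum_list lam"
  let ?t = "transpose (res ?n i) (res ?n (i + 1))"
  obtain f where T: "T = row_sets lam f" and f: "filling lam f"
    using assms by (auto simp: tabloids_def)
  have "bij_betw ?t (residue_classes ?n) (residue_classes ?n)"
    by (intro bij_betw_byWitness[of _ ?t]) (auto simp: transpose_def)
  with f have "filling lam (?t \<circ> f)"
    by (auto simp: filling_def intro: bij_betw_trans)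
  moreover have "exchange ?n i T = row_sets lam (?t \<circ> f)"
    by (auto simp: T exchange_def row_sets_def)
  ultimately show ?thesis by (auto simp: tabloids_def)
qed

section \<open>Circular words and their Knuth moves\<close>

text \<open>
  The word \<open>W\<close> is written clockwise on the circle of residue classes, starting at \<open>c\<close>:
  the class of \<open>c + j\<close> lies in row \<open>W ! j\<close>.
\<close>

definition circular_tabloid :: "nat \<Rightarrow> int \<Rightarrow> nat list \<Rightarrow> tabloid" where
  "circular_tabloid b c W =
     tabloid_of_rows (length W) b (\<lambda>x. W ! nat ((x - c) mod int (length W)))"

lemma circular_tabloid_rotate:
  "circular_tabloid b c (x # V) = circular_tabloid b (c + 1) (V @ [x])"
proof -
  let ?n = "int (Suc (length V))"
  have "(x # V) ! nat ((z - c) mod ?n) = (V @ [x]) ! nat ((z - (c + 1)) mod ?n)" for z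
  proof (cases "(z - c) mod ?n = 0")
    case True
    then have "(z - (c + 1)) mod ?n = (0 - 1) mod ?n"
      by (metis diff_diff_add mod_diff_left_eq)
    also have "\<dots> = int (length V)"
      by (simp add: zmod_minus1)
    finally show ?thesis using True by simp
  next
    case False
    define m where "m = (z - c) mod ?n"
    have m: "0 < m" "m < ?n" using False 
      using pos_mod_bound[of ?n "z - c"] pos_mod_sign[of ?n "z - c"]
      unfolding m_def by linarith+
    have "(z - (c + 1)) mod ?n = (m - 1) mod ?n"
      by (simp add: m_def mod_simps algebra_simps)
    also have "\<dots> = m - 1" using m by simp
    finally have "(z - (c + 1)) mod ?n = m - 1" .
    moreover have "nat m = Suc (nat (m - 1))" "nat (m - 1) < length V" using m by auto
    ultimately show ?thesis by (simp only: m_def[symmetric]) (simp add: nth_append)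
  qed
  then show ?thesis by (simp add: circular_tabloid_def)
qed

lemma nat_mod_less: "0 < n \<Longrightarrow> nat (x mod int n) < n"
  by (simp add: nat_less_iff)

lemma circular_position:
  assumes "j < n"
  shows "(res n (c + int j) - c) mod int n = int j"
proof -
  have "(res n (c + int j) - c) mod int n = int j mod int n"
    by (simp add: res_def mod_simps)
  with assms show ?thesis by simp
qed

text \<open>
  The pair formed by the last and the first letter is excluded: the Knuth relations of a linear word
  involve only pairs inside it.
\<close>

lemma Des_circular_tabloid:
  assumes "set W \<subseteq> {..<b}" "Suc j < length W"
  shows "res (length W) (c + int j) \<in> Des (length W) (circular_tabloid b c W) \<longleftrightarrow> W ! j < W ! Suc j"
proof -
  let ?n = "length W"
  let ?w = "\<lambda>x. W ! nat ((x - c) mod int ?n)"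
  have "\<forall>x \<in> residue_classes ?n. ?w x < b"
  proof
    fix x
    have "nat ((x - c) mod int ?n) < ?n"
      using assms(2) by (intro nat_mod_less) linarith
    then have "?w x \<in> set W" by (rule nth_mem)
    with assms(1) show "?w x < b" by blast
  qed
  then have "Des ?n (circular_tabloid b c W) =
      {i \<in> residue_classes ?n. ?w i < ?w (res ?n (i + 1))}"
    unfolding circular_tabloid_def by (rule Des_tabloid_of_rows)
  then have "res ?n (c + int j) \<in> Des ?n (circular_tabloid b c W) \<longleftrightarrow>
      ?w (res ?n (c + int j)) < ?w (res ?n (res ?n (c + int j) + 1))"
    by (simp only: mem_Collect_eq res_in_residue_classes simp_thms)
  also have "res ?n (res ?n (c + int j) + 1) = res ?n (c + int (Suc j))"
    by (simp add: add.assoc add.commute[of 1])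
  also have "?w (res ?n (c + int j)) = W ! j"
    using assms by (simp only: circular_position Suc_lessD nat_int)
  also have "?w (res ?n (c + int (Suc j))) = W ! Suc j"
    using assms by (simp only: circular_position nat_int)
  finally show ?thesis .
qed

lemma exchange_circular_tabloid:
  assumes "Suc j < length W"
  shows "exchange (length W) (c + int j) (circular_tabloid b c W) =
    circular_tabloid b c (W[j := W ! Suc j, Suc j := W ! j])"
proof -
  let ?n = "length W"
  let ?W = "W[j := W ! Suc j, Suc j := W ! j]"
  let ?t = "transpose (res ?n (c + int j)) (res ?n (c + int j + 1))"
  have "W ! nat ((?t x - c) mod int ?n) = ?W ! nat ((x - c) mod int ?n)"
    if "x \<in> residue_classes ?n" for x
  proof -
    define i where "i = nat ((x - c) mod int ?n)"
    have n: "0 < ?n" using assms by linarith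
    have i: "i < ?n"
      unfolding i_def using n by (rule nat_mod_less)
    have int_i: "int i = (x - c) mod int ?n"
      unfolding i_def using n by simp
    have x: "x = res ?n (c + int i)"
    proof -
      have "(c + (x - c) mod int ?n) mod int ?n = x mod int ?n"
        unfolding mod_add_right_eq by (rule arg_cong) simp
      then show ?thesis
        unfolding int_i using res_of_residue[OF that] by (simp only: res_def)
    qed
    have inj: "res ?n (c + int k) = res ?n (c + int l) \<longleftrightarrow> k = l" if "k < ?n" "l < ?n" for k l
      using circular_position[OF that(1), of c] circular_position[OF that(2), of c]
      by (metis of_nat_eq_iff)
    have s: "c + int j + 1 = c + int (Suc j)" by simp
    consider "i = j" | "i = Suc j" | "i \<noteq> j" "i \<noteq> Suc j" by blast
    then have "W ! nat ((?t x - c) mod int ?n) = ?W ! i"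
    proof cases
      case 1
      then have "?t x = res ?n (c + int (Suc j))" by (simp only: x s transpose_apply_first)
      with 1 assms show ?thesis by (simp only: circular_position nat_int) simp
    next
      case 2
      then have "?t x = res ?n (c + int j)" by (simp only: x s transpose_apply_second)
      with 2 assms show ?thesis by (simp only: circular_position nat_int Suc_lessD) simp
    next
      case 3
      then have "?t x = res ?n (c + int i)"
        unfolding x s using i assms by (simp add: transpose_def inj del: of_nat_Suc)
      with 3 i show ?thesis by (simp only: circular_position nat_int) simp
    qed
    then show ?thesis by (simp add: i_def)
  qed
  then show ?thesis
    unfolding circular_tabloid_def exchange_tabloid_of_rows
    by (auto intro!: tabloid_of_rows_cong)
qed

abbreviation typed_move :: "nat \<Rightarrow> tabloid \<Rightarrow> tabloid \<Rightarrow> bool" where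
  "typed_move n T T' \<equiv> \<exists>k. knuth_move_of_type n k T T'"

text \<open>
  Within the three consecutive letters of a plactic relation exactly one of the two adjacent pairs is a
  descent, and the relation interchanges which of them.  This is the incomparability of the descent
  sets, and it gives the type of the move as the position of the first of the three letters.
\<close>

lemma plactic_step_is_knuth_move:
  assumes "plactic_step W W'" "set W \<subseteq> {..<b}"
  shows "typed_move (length W) (circular_tabloid b c W) (circular_tabloid b c W')"
proof -
  let ?n = "length W"
  let ?T = "circular_tabloid b c W" and ?T' = "circular_tabloid b c W'"
  have W': "set W' \<subseteq> {..<b}" "length W' = ?n"
    using assms plactic_step_mset mset_eq_setD mset_eq_length by metis+
  \<comment> \<open>The letters in positions j and j+1 are exchanged; the three letters start in position i.\<close>
  have "\<exists>j i. W' = W[j := W ! Suc j, Suc j := W ! j] \<and> Suc j < ?n \<and> Suc (Suc i) < ?n \<and>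
     (W ! i < W ! Suc i \<longleftrightarrow> \<not> W ! Suc i < W ! Suc (Suc i)) \<and>
     (W' ! i < W' ! Suc i \<longleftrightarrow> \<not> W' ! Suc i < W' ! Suc (Suc i)) \<and>
     (W ! i < W ! Suc i \<longleftrightarrow> \<not> W' ! i < W' ! Suc i)"
    using assms(1)
  proof cases
    case (left_witness x y z U V)
    then show ?thesis
      by (intro exI[of _ "Suc (length U)"] exI[of _ "length U"])
        (auto simp: nth_append list_update_append)
  next
    case (right_witness x y z U V)
    then show ?thesis
      by (intro exI[of _ "length U"] exI[of _ "length U"])
        (auto simp: nth_append list_update_append)
  qed
  then obtain j i where j: "W' = W[j := W ! Suc j, Suc j := W ! j]" "Suc j < ?n"
    and i: "Suc (Suc i) < ?n"
     "(W ! i < W ! Suc i \<longleftrightarrow> \<not> W ! Suc i < W ! Suc (Suc i))"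
     "(W' ! i < W' ! Suc i \<longleftrightarrow> \<not> W' ! Suc i < W' ! Suc (Suc i))"
     "(W ! i < W ! Suc i \<longleftrightarrow> \<not> W' ! i < W' ! Suc i)"
    by blast
  have move: "?T' = exchange ?n (c + int j) ?T"
    using j by (simp add: exchange_circular_tabloid)
  have s: "c + int i + 1 = c + int (Suc i)" by simp
  have D: "res ?n (c + int i) \<in> Des ?n ?T \<longleftrightarrow> W ! i < W ! Suc i"
    "res ?n (c + int i + 1) \<in> Des ?n ?T \<longleftrightarrow> W ! Suc i < W ! Suc (Suc i)"
    "res ?n (c + int i) \<in> Des ?n ?T' \<longleftrightarrow> W' ! i < W' ! Suc i"
    "res ?n (c + int i + 1) \<in> Des ?n ?T' \<longleftrightarrow> W' ! Suc i < W' ! Suc (Suc i)"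
    unfolding s
    using Des_circular_tabloid[OF assms(2), of i c] Des_circular_tabloid[OF assms(2), of "Suc i" c]
     Des_circular_tabloid[OF W'(1), of i c] Des_circular_tabloid[OF W'(1), of "Suc i" c] W'(2) i(1)
    by auto
  then have "knuth_move_of_type ?n (c + int i) ?T ?T'"
    unfolding knuth_move_of_type_def knuth_move_def
    using move i(2-4) by blast
  then show ?thesis by blast
qed

lemma plactic_steps_are_knuth_moves:
  assumes "plactic_step\<^sup>*\<^sup>* W W'" "set W \<subseteq> {..<b}"
  shows "(typed_move (length W))\<^sup>*\<^sup>* (circular_tabloid b c W) (circular_tabloid b c W')"
  using assms
proof (induction rule: rtranclp_induct)
  case (step Y Z)
  then have "set Y \<subseteq> {..<b}" "length Y = length W"
    by (metis mset_eq_setD mset_eq_length plactic_steps_mset)+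
  then show ?case
    using plactic_step_is_knuth_move[OF step(2), of b c] step
    by (metis (no_types, lifting) rtranclp.rtrancl_into_rtrancl)
qed simp

text \<open>
  The word is cut into a part \<open>V\<close> still to be treated and a weakly decreasing part \<open>R\<close>.  Turning the
  cut by one position takes the first letter \<open>x\<close> of \<open>V\<close> to the end of \<open>R\<close>.  Either \<open>R\<close> becomes
  longer, or inserting \<open>x\<close> into \<open>R\<close> returns a smaller letter \<open>y\<close> to the end of \<open>V\<close>.  Both
  cases decrease \<open>length V + sum_list V\<close>, so finally \<open>V\<close> is empty.
\<close>

lemma circular_word_sortable:
  assumes "sorted_wrt (\<ge>) R" "set (V @ R) \<subseteq> {..<b}" "length (V @ R) = n"
  shows "\<exists>c' R'. (typed_move n)\<^sup>*\<^sup>* (circular_tabloid b c (V @ R)) (circular_tabloid b c' R') \<and>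
    sorted_wrt (\<ge>) R' \<and> mset R' = mset (V @ R)"
  using assms
proof (induction "length V + sum_list V" arbitrary: V R c rule: less_induct)
  case less
  show ?case
  proof (cases V)
    case Nil
    then show ?thesis using less.prems by auto
  next
    case (Cons x V')
    have rot: "circular_tabloid b c (V @ R) = circular_tabloid b (c + 1) (V' @ R @ [x])"
      by (simp add: Cons circular_tabloid_rotate)
    show ?thesis
    proof (cases "sorted_wrt (\<ge>) (R @ [x])")
      case True
      have "\<exists>c' R'. (typed_move n)\<^sup>*\<^sup>* (circular_tabloid b (c + 1) (V' @ R @ [x]))
          (circular_tabloid b c' R') \<and> sorted_wrt (\<ge>) R' \<and> mset R' = mset (V' @ R @ [x])"
        using less.prems by (intro less.hyps True) (auto simp: Cons)
      moreover have "mset (V' @ R @ [x]) = mset (V @ R)" by (simp add: Cons)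
      ultimately show ?thesis unfolding rot by metis
    next
      case False
      then obtain y R' where y: "plactic_step\<^sup>*\<^sup>* (R @ [x]) (y # R')" "sorted_wrt (\<ge>) R'" "y < x"
        using row_insertion less.prems(1) by blast
      have steps: "plactic_step\<^sup>*\<^sup>* (V' @ R @ [x]) ((V' @ [y]) @ R')"
        using plactic_steps_context[OF y(1), of V' "[]"] by simp
      have m: "mset ((V' @ [y]) @ R') = mset (V @ R)"
        using plactic_steps_mset[OF steps] by (simp add: Cons)
      have "\<exists>c' R''. (typed_move n)\<^sup>*\<^sup>* (circular_tabloid b (c + 1) ((V' @ [y]) @ R'))
          (circular_tabloid b c' R'') \<and> sorted_wrt (\<ge>) R'' \<and> mset R'' = mset ((V' @ [y]) @ R')"
      proof (rule less.hyps)
        show "length (V' @ [y]) + sum_list (V' @ [y]) < length V + sum_list V"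
          using y(3) by (simp add: Cons)
        show "set ((V' @ [y]) @ R') \<subseteq> {..<b}"
          using mset_eq_setD[OF m] less.prems by simp
        show "length ((V' @ [y]) @ R') = n"
          using mset_eq_length[OF m] less.prems by simp
      qed fact
      moreover have "(typed_move n)\<^sup>*\<^sup>* (circular_tabloid b (c + 1) (V' @ R @ [x]))
          (circular_tabloid b (c + 1) ((V' @ [y]) @ R'))"
        using plactic_steps_are_knuth_moves[OF steps, of b "c + 1"] less.prems by (simp add: Cons)
      ultimately show ?thesis
        unfolding rot m by (meson rtranclp_trans)
    qed
  qed
qed

section \<open>Every tabloid is connected to a row superstandard one\<close>

definition row_word :: "nat list \<Rightarrow> nat list" where
  "row_word lam = concat (map (\<lambda>r. replicate (lam ! r) r) [0..<length lam])"

lemma row_word_snoc: "row_word (lam @ [m]) = row_word lam @ replicate m (length lam)"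
proof -
  have "map (\<lambda>r. replicate ((lam @ [m]) ! r) r) [0..<length lam] =
      map (\<lambda>r. replicate (lam ! r) r) [0..<length lam]"
    by (auto simp: nth_append)
  then show ?thesis by (simp add: row_word_def del: map_eq_conv)
qed

lemma set_row_word: "set (row_word lam) \<subseteq> {..<length lam}"
  by (auto simp: row_word_def)

lemma sorted_row_word: "sorted (row_word lam)"
proof (induction lam rule: rev_induct)
  case (snoc m lam)
  then show ?case
    using set_row_word[of lam] by (auto simp: row_word_snoc sorted_append sorted_replicate less_imp_le)
qed (simp add: row_word_def)

lemma length_row_word: "length (row_word lam) = sum_list lam"
  by (induction lam rule: rev_induct) (simp_all add: row_word_snoc, simp add: row_word_def)

lemma mset_row_word: "mset (row_word lam) = image_mset fst (mset_set (diagram lam))"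
proof (induction lam rule: rev_induct)
  case Nil
  then show ?case by (simp add: row_word_def diagram_def)
next
  case (snoc m lam)
  let ?E = "Pair (length lam) ` {..<m}"
  have "diagram (lam @ [m]) = diagram lam \<union> ?E"
    by (auto simp: diagram_def nth_append less_Suc_eq)
  moreover have "diagram lam \<inter> ?E = {}" by (auto simp: diagram_def)
  moreover have "finite (diagram lam)" by (simp add: diagram_eq_Sigma)
  moreover have "image_mset fst (mset_set ?E) = replicate_mset m (length lam)"
  proof -
    have "mset_set ?E = image_mset (Pair (length lam)) (mset_set {..<m})"
      by (intro image_mset_mset_set[symmetric]) (auto simp: inj_on_def)
    then show ?thesis by (simp add: multiset.map_comp comp_def image_mset_const_eq)
  qed
  ultimately show ?case by (simp add: row_word_snoc snoc mset_set_Union)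
qed

lemma row_word_nth:
  assumes "j < sum_list lam"
  shows "row_word lam ! j = r \<longleftrightarrow>
    r < length lam \<and> (\<exists>c < lam ! r. j = sum_list (take r lam) + c)"
  using assms
proof (induction lam rule: rev_induct)
  case (snoc m lam)
  show ?case
  proof (cases "j < sum_list lam")
    case True
    have "row_word (lam @ [m]) ! j = row_word lam ! j"
      using True by (simp add: row_word_snoc nth_append length_row_word)
    then show ?thesis
      using snoc.IH[OF True] True by (cases r "length lam" rule: linorder_cases) (auto simp: nth_append)
  next
    case False
    have "row_word (lam @ [m]) ! j = length lam"
      using False snoc.prems by (simp add: row_word_snoc nth_append length_row_word)
    moreover have "sum_list (take r lam) + lam ! r \<le> sum_list lam" if "r < length lam"
    proof -
      have "sum_list lam = sum_list (take r lam) + sum_list (drop r lam)"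
        by (metis append_take_drop_id sum_list_append)
      then show ?thesis using that by (simp add: Cons_nth_drop_Suc[symmetric])
    qed
    ultimately show ?thesis
      using False snoc.prems
      by (cases r "length lam" rule: linorder_cases)
        (fastforce simp: nth_append intro: exI[of _ "j - sum_list lam"])+
  qed
qed simp

text \<open>
  A weakly decreasing word is determined by its content.  Read backwards from the last position it
  runs through the rows from top to bottom, which is how the row superstandard tabloid is filled.
\<close>

lemma sorted_circular_tabloid_is_RRSS:
  assumes "sorted_wrt (\<ge>) R" "mset R = mset (row_word lam)" "sum_list lam > 0"
  shows "circular_tabloid (length lam) c R = RRSS lam (c + int (sum_list lam) - 1)"
proof -
  define n where "n = sum_list lam"
  let ?k = "c + int n - 1"
  have len: "length R = n"
    using mset_eq_length[OF assms(2)] by (simp add: length_row_word n_def)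
  have n: "n > 0" using assms by (simp add: n_def)
  have "sorted (rev R)" using assms(1) by (simp add: sorted_wrt_rev)
  then have rev: "rev R = row_word lam"
    using assms(2) sorted_row_word by (metis mset_rev properties_for_sort)
  have letter: "R ! nat ((x - c) mod int n) = row_word lam ! nat ((?k - x) mod int n)" for x
  proof -
    define j where "j = (?k - x) mod int n"
    have j: "0 \<le> j" "j < int n" using n by (auto simp: j_def)
    have "x - c = int n - 1 - (?k - x)" by simp
    then have "(x - c) mod int n = (int n - 1 - j) mod int n"
      unfolding j_def by (metis mod_diff_right_eq)
    also have "\<dots> = int n - 1 - j" using j by simp
    finally have x: "(x - c) mod int n = int n - 1 - j" .
    have "row_word lam ! nat j = R ! (n - Suc (nat j))"
      using j len by (simp add: rev[symmetric] rev_nth nat_less_iff)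
    moreover have "n - Suc (nat j) = nat (int n - 1 - j)" using j by linarith
    ultimately show ?thesis by (simp add: x j_def)
  qed
  have "{x \<in> residue_classes n. R ! nat ((x - c) mod int n) = r} =
      {res n (?k - int (sum_list (take r lam)) - int c') |c'. c' < lam ! r}"
    (is "?A = ?B") if r: "r < length lam" for r
  proof (intro equalityI subsetI)
    fix x assume x: "x \<in> ?A"
    define j where "j = nat ((?k - x) mod int n)"
    have j: "j < n" "int j = res n (?k - x)"
      using n by (auto simp: j_def res_def nat_less_iff)
    have "row_word lam ! j = r" using x by (simp add: letter j_def)
    with j(1) obtain c' where "c' < lam ! r" "j = sum_list (take r lam) + c'"
      unfolding n_def using row_word_nth by blast
    moreover have "x = res n (?k - int j)"
      using x by (simp only: j(2)) (simp add: reflect_twice)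
    ultimately show "x \<in> ?B" by (auto simp: algebra_simps)
  next
    fix x assume "x \<in> ?B"
    then obtain c' where c': "c' < lam ! r" "x = res n (?k - int (sum_list (take r lam)) - int c')"
      by blast
    define j where "j = sum_list (take r lam) + c'"
    have "sum_list lam = sum_list (take r lam) + sum_list (drop r lam)"
      by (metis append_take_drop_id sum_list_append)
    then have j: "j < n" using c' r by (simp add: Cons_nth_drop_Suc[symmetric] j_def n_def)
    have "(?k - x) mod int n = int j mod int n"
      by (simp add: c' j_def res_def mod_simps)
    then have "nat ((?k - x) mod int n) = j" using j by simp
    moreover have "row_word lam ! j = r"
      using row_word_nth[of j lam r] j c' r by (auto simp: n_def j_def)
    ultimately show "x \<in> ?A" using c' by (simp add: letter)
  qed
  then show ?thesis
    by (simp add: circular_tabloid_def tabloid_of_rows_def RRSS_def row_sets_def len n_def[symmetric])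
qed

lemma connected_to_RRSS:
  assumes T: "T \<in> tabloids lam"
  shows "\<exists>k. (typed_move (sum_list lam))\<^sup>*\<^sup>* T (RRSS lam k)"
proof -
  let ?n = "sum_list lam" and ?b = "length lam"
  have n: "?n > 0" using T by (rule tabloids_size_pos)
  from T obtain w where w: "T = tabloid_of_rows ?n ?b w" "\<forall>x \<in> residue_classes ?n. w x < ?b"
    "image_mset w (mset_set (residue_classes ?n)) = image_mset fst (mset_set (diagram lam))"
    by (rule tabloid_row_function)
  define W where "W = map (\<lambda>i. w (int i)) [0..<?n]"
  have W: "length W = ?n" "set W \<subseteq> {..<?b}"
    using w(2) n by (auto simp: W_def residue_classes_eq)
  have "T = circular_tabloid ?b 0 W"
    unfolding w(1) circular_tabloid_def W(1)
    using n by (intro tabloid_of_rows_cong) (auto simp: W_def residue_classes_eq nat_less_iff)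
  moreover have m: "mset W = mset (row_word lam)"
  proof -
    have "int ` {0..<?n} = residue_classes ?n"
      using n by (simp add: residue_classes_eq image_int_atLeastLessThan)
    then have "mset_set (residue_classes ?n) = image_mset int (mset_set {0..<?n})"
      by (metis image_mset_mset_set inj_on_of_nat)
    then show ?thesis
      by (simp add: mset_row_word w(3)[symmetric] W_def multiset.map_comp comp_def)
  qed
  moreover obtain c R where "(typed_move ?n)\<^sup>*\<^sup>* (circular_tabloid ?b 0 W) (circular_tabloid ?b c R)"
    "sorted_wrt (\<ge>) R" "mset R = mset W"
    using circular_word_sortable[of "[]" W ?b ?n 0] W by auto
  ultimately show ?thesis
    using sorted_circular_tabloid_is_RRSS[of R lam c] n by metis
qed

section \<open>Uniqueness of affine evacuation\<close>

text \<open>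
  Let \<open>A\<close>, \<open>B\<close>, \<open>C\<close> be the classes of \<open>k\<close>, \<open>k + 1\<close>, \<open>k + 2\<close>.  A move of type \<open>k\<close> changes the
  status of both \<open>A\<close> and \<open>B\<close> as descents, so it exchanges \<open>A\<close> with \<open>B\<close> or \<open>B\<close> with \<open>C\<close>; which of
  the two is dictated by the comparison of the row of \<open>C\<close> with the rows of \<open>A\<close> and \<open>B\<close>.  For
  \<open>n = 3\<close> the exchange of \<open>C\<close> with \<open>A\<close> also touches both pairs, but it never turns a descent
  at \<open>A\<close> alone into a descent at \<open>B\<close> alone, nor conversely.  For \<open>n \<le> 2\<close> all exchanges
  coincide.
\<close>

lemma typed_move_unique:
  assumes T: "T \<in> tabloids lam"
    and T': "knuth_move_of_type (sum_list lam) k T T'"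
    and T'': "knuth_move_of_type (sum_list lam) k T T''"
  shows "T' = T''"
proof -
  define n where "n = sum_list lam"
  have n: "n > 0" using T unfolding n_def by (rule tabloids_size_pos)
  from T obtain w where w: "T = tabloid_of_rows n (length lam) w"
    "\<forall>x \<in> residue_classes n. w x < length lam"
    unfolding n_def by (rule tabloid_row_function)
  define A B C where ABC: "A = res n k" "B = res n (k + 1)" "C = res n (k + 2)"
  have next_res: "res n (A + 1) = B" "res n (B + 1) = C" "A \<in> residue_classes n" "B \<in> residue_classes n"
    by (simp_all add: ABC add.assoc)
  obtain i' i'' where i: "T' = exchange n i' T" "T'' = exchange n i'' T"
    using T' T'' by (auto simp: knuth_move_of_type_def knuth_move_def n_def)
  show ?thesis
  proof (cases "n \<ge> 3")
    case False
    have "exchange n i T = exchange n 0 T" for i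
    proof -
      consider "n = 1" | "n = 2" using n False by linarith
      then show ?thesis
      proof cases
        case 1
        then show ?thesis by (simp add: exchange_def res_def)
      next
        case 2
        then have "i mod 2 = 0 \<and> (i + 1) mod 2 = 1 \<or> i mod 2 = 1 \<and> (i + 1) mod 2 = 0"
          by presburger
        with 2 show ?thesis
          by (auto simp: exchange_def res_def transpose_commute)
      qed
    qed
    from this[of i'] this[of i''] show ?thesis unfolding i by simp
  next
    case True
    have less: "w x < length lam" if "x \<in> residue_classes n" for x
      using w that by blast
    have res_eq: "res n x = res n y \<longleftrightarrow> int n dvd x - y" for x y
      by (simp add: res_def mod_eq_dvd_iff)
    have distinct: "A \<noteq> B" "B \<noteq> C" "A \<noteq> C"
      using True by (auto simp: ABC res_eq zdvd_not_zless)
    have key: "exchange n i T =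
        (if w A < w C \<longleftrightarrow> w A < w B
         then exchange n k T else exchange n (k + 1) T)"
      if move: "knuth_move_of_type n k T (exchange n i T)" for i
    proof -
      define p q where pq: "p = res n i" "q = res n (i + 1)"
      let ?w = "w \<circ> transpose p q"
      have D: "Des n T = {i \<in> residue_classes n. w i < w (res n (i + 1))}"
        unfolding w(1) using w(2) by (rule Des_tabloid_of_rows)
      have D': "Des n (exchange n i T) = {i \<in> residue_classes n. ?w i < ?w (res n (i + 1))}"
        unfolding w(1) exchange_tabloid_of_rows pq[symmetric]
        using w(2) by (intro Des_tabloid_of_rows) (auto simp: transpose_def pq)
      have flip: "(w A < w B) \<noteq> (w B < w C)" "(?w A < ?w B) \<noteq> (?w B < ?w C)"
        "(w A < w B) \<noteq> (?w A < ?w B)"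
        using move next_res unfolding knuth_move_of_type_def D D' ABC(1,2)[symmetric] by auto
      have shift: "res n x = res n y \<longleftrightarrow> res n (x + 1) = res n (y + 1)" for x y
        by (simp add: res_eq)
      have pos: "p = A \<longleftrightarrow> q = B" "p = B \<longleftrightarrow> q = C"
        unfolding ABC pq using shift[of i k] shift[of i "k + 1"] by (simp_all add: add.assoc)
      have "p = A \<and> (w A < w C \<longleftrightarrow> w A < w B) \<or> p = B \<and> \<not> (w A < w C \<longleftrightarrow> w A < w B)"
      proof (cases "p = A \<or> p = B")
        case True
        then show ?thesis
        proof
          assume p: "p = A"
          with pos distinct have "?w A = w B" "?w B = w A" "?w C = w C"
            by (simp_all add: transpose_def)
          with flip p show ?thesis by linarith
        next
          assume p: "p = B"
          with pos distinct have "?w A = w A" "?w B = w C" "?w C = w B"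
            by (simp_all add: transpose_def)
          with flip p show ?thesis by linarith
        qed
      next
        case False
        with pos have wB: "?w B = w B" by (simp add: transpose_def)
        have "q = A"
        proof (rule ccontr)
          assume "q \<noteq> A"
          with False have "?w A = w A" by (simp add: transpose_def)
          with wB flip(3) show False by metis
        qed
        have "p = C"
        proof (rule ccontr)
          assume "p \<noteq> C"
          with \<open>q = A\<close> distinct have "?w C = w C" by (simp add: transpose_def)
          with wB have "?w B < ?w C \<longleftrightarrow> w B < w C" by (simp only:)
          with flip show False by blast
        qed
        with \<open>q = A\<close> distinct have "?w A = w C" "?w C = w A" by (simp_all add: transpose_def)
        with wB flip show ?thesis by linarith
      qed
      then show ?thesis
      proof
        assume "p = A \<and> (w A < w C \<longleftrightarrow> w A < w B)"
        then show ?thesis using pos(1) by (simp add: exchange_def pq ABC)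
      next
        assume "p = B \<and> \<not> (w A < w C \<longleftrightarrow> w A < w B)"
        then show ?thesis using pos(2) by (simp add: exchange_def pq ABC add.assoc)
      qed
    qed
    show ?thesis
      using key[of i'] key[of i''] T' T'' unfolding i n_def[symmetric] by metis
  qed
qed

lemma typed_move_in_tabloids:
  assumes "T \<in> tabloids lam" "knuth_move_of_type (sum_list lam) k T T'"
  shows "T' \<in> tabloids lam"
  using assms exchange_in_tabloids by (auto simp: knuth_move_of_type_def knuth_move_def)

text \<open>
  Two affine evacuations agree on the row superstandard tabloids.  Agreement propagates along an edge
  of type \<open>j\<close>, because both send it to the only edge of type \<open>n - j - 1\<close> at the common image
  of its endpoint, and by connectedness it reaches every tabloid.
\<close>

theorem affine_evacuation_unique:
  assumes e: "is_affine_evacuation lam e" and e': "is_affine_evacuation lam e'"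
  shows "e = e'"
proof -
  let ?n = "sum_list lam"
  have agree: "T \<in> tabloids lam \<longrightarrow> e T = e' T"
    if "(typed_move ?n)\<^sup>*\<^sup>* T (RRSS lam k)" for T k
    using that
  proof (induction rule: converse_rtranclp_induct)
    case base
    then show ?case using e e' by (simp add: is_affine_evacuation_def)
  next
    case (step T T')
    show ?case
    proof
      assume T: "T \<in> tabloids lam"
      from step obtain j where j: "knuth_move_of_type ?n j T T'" by blast
      have T': "T' \<in> tabloids lam" using T j by (rule typed_move_in_tabloids)
      have j': "knuth_move_of_type ?n j T' T"
      proof -
        obtain i where i: "T' = exchange ?n i T"
          using j by (auto simp: knuth_move_of_type_def knuth_move_def)
        have "exchange ?n i T' = T"
          by (simp add: i exchange_def comp_def image_image)
        with j show ?thesis by (auto simp: knuth_move_of_type_def knuth_move_def)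
      qed
      have "e T' = e' T'" using step T' by blast
      moreover have "e T' \<in> tabloids lam"
        using e T' by (auto simp: is_affine_evacuation_def knuth_automorphism_def bij_betw_def)
      moreover have "knuth_move_of_type ?n (int ?n - j - 1) (e T') (e T)"
        "knuth_move_of_type ?n (int ?n - j - 1) (e' T') (e' T)"
        using e e' T T' j' by (auto simp: is_affine_evacuation_def)
      ultimately show "e T = e' T" by (metis typed_move_unique)
    qed
  qed
  show ?thesis
  proof (rule extensionalityI)
    show "e \<in> extensional (tabloids lam)" "e' \<in> extensional (tabloids lam)"
      using e e' by (simp_all add: is_affine_evacuation_def)
    show "e T = e' T" if "T \<in> tabloids lam" for T
      using connected_to_RRSS[OF that] agree that by blast
  qed
qed

section \<open>Turning a rectangular tabloid upside down\<close>

lemma card_diagram: "card (diagram lam) = sum_list lam"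
proof -
  have "size (mset (row_word lam)) = card (diagram lam)"
    by (simp only: mset_row_word size_image_mset size_mset_set)
  then show ?thesis by (simp add: length_row_word)
qed

lemma RRSS_in_tabloids:
  assumes "sum_list lam > 0"
  shows "RRSS lam k \<in> tabloids lam"
proof -
  let ?n = "sum_list lam"
  let ?f = "\<lambda>(r, c). res ?n (k - int (sum_list (take r lam)) - int c)"
  have "?f ` diagram lam = residue_classes ?n"
  proof (intro equalityI subsetI)
    fix x assume x: "x \<in> residue_classes ?n"
    define j where "j = nat ((k - x) mod int ?n)"
    have j: "j < ?n" "int j = res ?n (k - x)"
      using assms by (simp_all add: j_def res_def nat_mod_less)
    then obtain c where "row_word lam ! j < length lam" "c < lam ! (row_word lam ! j)"
      "j = sum_list (take (row_word lam ! j) lam) + c"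
      using row_word_nth by metis
    then obtain r c where rc: "(r, c) \<in> diagram lam" "j = sum_list (take r lam) + c"
      by (auto simp: diagram_def)
    have "x = res ?n (k - int j)"
      using x unfolding j(2) by (simp add: reflect_twice)
    then have "x = ?f (r, c)" by (simp add: rc(2) algebra_simps)
    with rc(1) show "x \<in> ?f ` diagram lam" by blast
  qed auto
  moreover have "card (residue_classes ?n) = ?n"
    using assms by (simp add: residue_classes_eq)
  moreover have "finite (diagram lam)" by (simp add: diagram_eq_Sigma)
  ultimately have "filling lam ?f"
    unfolding filling_def bij_betw_def by (metis eq_card_imp_inj_on card_diagram)
  then show ?thesis by (auto simp: tabloids_def RRSS_def)
qed

definition upside_down :: "nat \<Rightarrow> tabloid \<Rightarrow> tabloid" where
  "upside_down n T = map (\<lambda>R. (\<lambda>x. res n (int n + 1 - x)) ` R) (rev T)"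

lemma res_add_modulus: "res n (int n + x) = res n x"
  by (simp add: res_def)

lemma res_reflect: "res n (c - res n x) = res n (c - x)"
  by (simp add: res_def mod_simps)

lemma upside_down_tabloid_of_rows:
  assumes w: "\<forall>x \<in> residue_classes n. w x < b"
  shows "upside_down n (tabloid_of_rows n b w) =
    tabloid_of_rows n b (\<lambda>x. b - 1 - w (res n (1 - x)))"
proof (rule nth_equalityI)
  show "length (upside_down n (tabloid_of_rows n b w)) =
    length (tabloid_of_rows n b (\<lambda>x. b - 1 - w (res n (1 - x))))"
    by (simp add: upside_down_def tabloid_of_rows_def)
next
  fix r assume "r < length (upside_down n (tabloid_of_rows n b w))"
  then have r: "r < b" by (simp add: upside_down_def tabloid_of_rows_def)
  have "(\<lambda>x. res n (int n + 1 - x)) ` {x \<in> residue_classes n. w x = b - Suc r} =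
      {x \<in> residue_classes n. b - 1 - w (res n (1 - x)) = r}" (is "?\<rho> ` ?A = ?B")
  proof (intro equalityI subsetI)
    fix y assume "y \<in> ?\<rho> ` ?A"
    then obtain x where "x \<in> residue_classes n" "w x = b - Suc r" "y = res n (1 - x)"
      by (auto simp: add_diff_eq[symmetric] res_add_modulus)
    then show "y \<in> ?B" using r by (simp add: reflect_twice)
  next
    fix y assume y: "y \<in> ?B"
    then have "w (res n (1 - y)) = b - Suc r" using w[rule_format, of "res n (1 - y)"] by auto
    moreover have "y = ?\<rho> (res n (1 - y))"
      using y by (simp add: add_diff_eq[symmetric] res_add_modulus reflect_twice)
    ultimately show "y \<in> ?\<rho> ` ?A" by (intro image_eqI[of _ _ "res n (1 - y)"]) auto
  qed
  then show "upside_down n (tabloid_of_rows n b w) ! r =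
      tabloid_of_rows n b (\<lambda>x. b - 1 - w (res n (1 - x))) ! r"
    using r by (simp add: upside_down_def tabloid_of_rows_def rev_nth)
qed

lemma upside_down_involution:
  assumes "T \<in> tabloids lam"
  shows "upside_down (sum_list lam) (upside_down (sum_list lam) T) = T"
proof -
  let ?n = "sum_list lam"
  obtain w where w: "T = tabloid_of_rows ?n (length lam) w" "\<forall>x \<in> residue_classes ?n. w x < length lam"
    using assms by (rule tabloid_row_function)
  have less: "w x < length lam" if "x \<in> residue_classes ?n" for x using w that by blast
  have "\<forall>x \<in> residue_classes ?n. length lam - 1 - w (res ?n (1 - x)) < length lam"
  proof
    fix x show "length lam - 1 - w (res ?n (1 - x)) < length lam"
      using less[of "res ?n (1 - x)"] by simp
  qed
  then show ?thesis
    unfolding w(1) using w(2)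
    by (simp add: upside_down_tabloid_of_rows)
      (intro tabloid_of_rows_cong, use less in \<open>fastforce simp: reflect_twice\<close>)
qed

text \<open>
  The reflection \<open>j \<mapsto> n + 1 - j\<close> sends the pair \<open>(i, i + 1)\<close> to \<open>(1 - i, - i)\<close>, which is
  \<open>(j, j + 1)\<close> with \<open>j = - i\<close> in the opposite order.  Reversing the rows compensates for the change
  of order.
\<close>

lemma Des_upside_down:
  assumes "T \<in> tabloids lam"
  shows "res (sum_list lam) i \<in> Des (sum_list lam) (upside_down (sum_list lam) T) \<longleftrightarrow>
    res (sum_list lam) (- i) \<in> Des (sum_list lam) T"
proof -
  let ?n = "sum_list lam" and ?b = "length lam"
  obtain w where w: "T = tabloid_of_rows ?n ?b w" "\<forall>x \<in> residue_classes ?n. w x < ?b"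
    using assms by (rule tabloid_row_function)
  let ?w = "\<lambda>x. ?b - 1 - w (res ?n (1 - x))"
  have less: "w x < ?b" if "x \<in> residue_classes ?n" for x using w that by blast
  have w': "\<forall>x \<in> residue_classes ?n. ?w x < ?b"
  proof
    fix x show "?w x < ?b" using less[of "res ?n (1 - x)"] by simp
  qed
  have "res ?n i \<in> Des ?n (upside_down ?n T) \<longleftrightarrow> ?w (res ?n i) < ?w (res ?n (res ?n i + 1))"
    unfolding w(1) upside_down_tabloid_of_rows[OF w(2)] Des_tabloid_of_rows[OF w'] by simp
  also have "\<dots> \<longleftrightarrow> w (res ?n (- i)) < w (res ?n (1 - i))"
    using less[of "res ?n (- i)"] less[of "res ?n (1 - i)"] by (auto simp: res_reflect)
  also have "\<dots> \<longleftrightarrow> res ?n (- i) \<in> Des ?n T"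
    unfolding w(1) Des_tabloid_of_rows[OF w(2)] by simp
  finally show ?thesis .
qed

lemma upside_down_exchange:
  assumes "T \<in> tabloids lam"
  shows "upside_down (sum_list lam) (exchange (sum_list lam) i T) =
    exchange (sum_list lam) (- i) (upside_down (sum_list lam) T)"
proof -
  let ?n = "sum_list lam" and ?b = "length lam"
  obtain w where w: "T = tabloid_of_rows ?n ?b w" "\<forall>x \<in> residue_classes ?n. w x < ?b"
    using assms by (rule tabloid_row_function)
  let ?t = "transpose (res ?n i) (res ?n (i + 1))"
  let ?t' = "transpose (res ?n (- i)) (res ?n (- i + 1))"
  have wt: "\<forall>x \<in> residue_classes ?n. (w \<circ> ?t) x < ?b"
    using w(2) by (auto simp: transpose_def)
  have conjugate: "?t (res ?n (1 - x)) = res ?n (1 - ?t' x)" if x: "x \<in> residue_classes ?n" for x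
  proof -
    have "res ?n (1 - x) = res ?n i \<longleftrightarrow> x = res ?n (- i + 1)"
      "res ?n (1 - x) = res ?n (i + 1) \<longleftrightarrow> x = res ?n (- i)"
      using reflect_twice[OF x, of 1] res_reflect[of ?n 1 i] res_reflect[of ?n 1 "i + 1"]
       res_reflect[of ?n 1 "- i"] res_reflect[of ?n 1 "- i + 1"]
      by (auto simp: add.commute)
    then show ?thesis by (auto simp: transpose_def res_reflect add.commute)
  qed
  show ?thesis
    unfolding w(1) exchange_tabloid_of_rows upside_down_tabloid_of_rows[OF wt]
      upside_down_tabloid_of_rows[OF w(2)]
    by (intro tabloid_of_rows_cong) (simp add: conjugate)
qed

lemma knuth_move_upside_down:
  assumes T: "T \<in> tabloids lam" "T' \<in> tabloids lam" and move: "knuth_move (sum_list lam) T T'"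
  shows "knuth_move (sum_list lam) (upside_down (sum_list lam) T) (upside_down (sum_list lam) T')"
proof -
  let ?n = "sum_list lam" and ?U = "upside_down (sum_list lam)"
  have not_subset: "\<not> Des ?n (?U S) \<subseteq> Des ?n (?U S')"
    if "S \<in> tabloids lam" "S' \<in> tabloids lam" "\<not> Des ?n S \<subseteq> Des ?n S'" for S S'
  proof -
    from that obtain x where "x \<in> Des ?n S" "x \<notin> Des ?n S'" by blast
    moreover from this have "x = res ?n x" by (simp add: Des_def)
    ultimately have "res ?n (- (- x)) \<in> Des ?n S" "res ?n (- (- x)) \<notin> Des ?n S'" by auto
    then show ?thesis using that Des_upside_down by blast
  qed
  from move obtain i where "T' = exchange ?n i T" by (auto simp: knuth_move_def)
  then have "?U T' = exchange ?n (- i) (?U T)" using upside_down_exchange[OF T(1)] by simp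
  with move not_subset T show ?thesis unfolding knuth_move_def by blast
qed

text \<open>
  The rectangular shape enters here: reversing the rows preserves the shape because all rows have the
  same length.
\<close>

lemma upside_down_in_tabloids:
  assumes "T \<in> tabloids (replicate b a)"
  shows "upside_down (b * a) T \<in> tabloids (replicate b a)"
proof -
  let ?lam = "replicate b a" and ?n = "b * a"
  have sum: "sum_list ?lam = ?n" by (simp add: sum_list_replicate)
  obtain f where T: "T = row_sets ?lam f" and f: "filling ?lam f"
    using assms by (auto simp: tabloids_def)
  let ?\<rho> = "\<lambda>x. res ?n (int ?n + 1 - x)"
  let ?flip = "\<lambda>(r, c). (b - Suc r, c :: nat)"
  have "bij_betw ?flip (diagram ?lam) (diagram ?lam)"
    by (intro bij_betw_byWitness[of _ ?flip]) (auto simp: diagram_def)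
  moreover have "bij_betw ?\<rho> (residue_classes ?n) (residue_classes ?n)"
    by (intro bij_betw_byWitness[of _ ?\<rho>]) (auto simp: reflect_twice)
  ultimately have "filling ?lam (?\<rho> \<circ> (f \<circ> ?flip))"
    using f unfolding filling_def sum by (blast intro: bij_betw_trans)
  moreover have "upside_down ?n T = row_sets ?lam (?\<rho> \<circ> (f \<circ> ?flip))"
    by (rule nth_equalityI) (auto simp: upside_down_def T row_sets_def rev_nth)
  ultimately show ?thesis by (auto simp: tabloids_def)
qed

text \<open>
  The entry in column \<open>c\<close> of the row that comes from the opposite side is matched with the entry in
  column \<open>a - 1 - c\<close>.
\<close>

lemma upside_down_RRSS:
  "upside_down (b * a) (RRSS (replicate b a) k) = RRSS (replicate b a) (int (b * a) - k)"
proof (rule nth_equalityI)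
  show "length (upside_down (b * a) (RRSS (replicate b a) k)) =
      length (RRSS (replicate b a) (int (b * a) - k))"
    by (simp add: upside_down_def RRSS_def row_sets_def)
next
  let ?n = "b * a"
  fix r assume "r < length (upside_down (b * a) (RRSS (replicate b a) k))"
  then have r: "r < b" by (simp add: upside_down_def RRSS_def row_sets_def)
  let ?row = "\<lambda>k r. {res ?n (k - int (r * a) - int c) |c. c < a}"
  have RRSS: "RRSS (replicate b a) k ! r = ?row k r" if "r < b" for r k
    using that by (auto simp: RRSS_def row_sets_def sum_list_replicate take_replicate)
  have entry: "res ?n (int ?n + 1 - res ?n (k - int ((b - Suc r) * a) - int c)) =
      res ?n (int ?n - k - int (r * a) - int (a - Suc c))" if "c < a" for c
  proof -
    have ab: "int ((b - Suc r) * a) = int ?n - int (r * a) - int a"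
    proof -
      have "int (b - Suc r) = int b - int r - 1" using r by simp
      then show ?thesis unfolding of_nat_mult by (simp only: left_diff_distrib mult_1)
    qed
    have "res ?n (int ?n + 1 - (k - int ((b - Suc r) * a) - int c)) =
        res ?n (int ?n + (int ?n - k - int (r * a) - int (a - Suc c)))"
      unfolding ab using that by (intro arg_cong[of _ _ "res ?n"]) (simp add: of_nat_diff)
    then show ?thesis by (simp only: res_reflect res_add_modulus)
  qed
  have "(\<lambda>x. res ?n (int ?n + 1 - x)) ` ?row k (b - Suc r) = ?row (int ?n - k) r"
  proof (intro equalityI subsetI)
    fix y assume "y \<in> (\<lambda>x. res ?n (int ?n + 1 - x)) ` ?row k (b - Suc r)"
    then obtain c where "c < a" "y = res ?n (int ?n - k - int (r * a) - int (a - Suc c))"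
      using entry by blast
    moreover from this have "a - Suc c < a" by simp
    ultimately show "y \<in> ?row (int ?n - k) r" by blast
  next
    fix y assume "y \<in> ?row (int ?n - k) r"
    then obtain c where c: "c < a" "y = res ?n (int ?n - k - int (r * a) - int c)" by blast
    then have c': "a - Suc c < a" "a - Suc (a - Suc c) = c" by auto
    let ?x = "res ?n (k - int ((b - Suc r) * a) - int (a - Suc c))"
    have "y = res ?n (int ?n + 1 - ?x)"
      unfolding entry[OF c'(1)] c(2) c'(2) ..
    moreover have "?x \<in> ?row k (b - Suc r)" using c'(1) by blast
    ultimately show "y \<in> (\<lambda>x. res ?n (int ?n + 1 - x)) ` ?row k (b - Suc r)"
      by (rule image_eqI)
  qed
  moreover have "upside_down ?n (RRSS (replicate b a) k) ! r =
      (\<lambda>x. res ?n (int ?n + 1 - x)) ` (RRSS (replicate b a) k ! (b - Suc r))"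
  proof -
    have "length (RRSS (replicate b a) k) = b" by (simp add: RRSS_def row_sets_def)
    then show ?thesis using r by (simp add: upside_down_def rev_nth)
  qed
  ultimately show "upside_down ?n (RRSS (replicate b a) k) ! r =
      RRSS (replicate b a) (int ?n - k) ! r"
    using r by (simp only: RRSS)
qed

theorem upside_down_is_affine_evacuation:
  assumes "b * a > 0"
  shows "is_affine_evacuation (replicate b a)
    (restrict (upside_down (b * a)) (tabloids (replicate b a)))"
proof -
  let ?lam = "replicate b a" and ?n = "b * a"
  let ?U = "upside_down ?n"
  have sum: "sum_list ?lam = ?n" by (simp add: sum_list_replicate)
  have inT: "?U T \<in> tabloids ?lam" if "T \<in> tabloids ?lam" for T
    using that by (rule upside_down_in_tabloids)
  have invol: "?U (?U T) = T" if "T \<in> tabloids ?lam" for T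
    using upside_down_involution[OF that] by (simp only: sum)
  have move: "knuth_move ?n (?U T) (?U T')"
    if "T \<in> tabloids ?lam" "T' \<in> tabloids ?lam" "knuth_move ?n T T'" for T T'
    using knuth_move_upside_down[of T ?lam T'] that by (simp only: sum)
  have automorphism: "knuth_automorphism ?lam (restrict ?U (tabloids ?lam))"
    unfolding knuth_automorphism_def sum
  proof (intro conjI ballI)
    show "bij_betw (restrict ?U (tabloids ?lam)) (tabloids ?lam) (tabloids ?lam)"
      by (intro bij_betw_byWitness[of _ ?U]) (auto simp: inT invol)
    fix T T' assume T: "T \<in> tabloids ?lam" "T' \<in> tabloids ?lam"
    show "knuth_move ?n T T' \<longleftrightarrow>
        knuth_move ?n (restrict ?U (tabloids ?lam) T) (restrict ?U (tabloids ?lam) T')"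
      using T move[OF T] move[of "?U T" "?U T'"] by (auto simp: inT invol)
  qed
  have type: "knuth_move_of_type ?n (int ?n - k - 1) (?U T) (?U T')"
    if T: "T \<in> tabloids ?lam" "T' \<in> tabloids ?lam" and k: "knuth_move_of_type ?n k T T'" for k T T'
  proof -
    have D: "res ?n (int ?n - k - 1) \<in> Des ?n (?U S) \<longleftrightarrow> res ?n (k + 1) \<in> Des ?n S"
      "res ?n (int ?n - k - 1 + 1) \<in> Des ?n (?U S) \<longleftrightarrow> res ?n k \<in> Des ?n S"
      if "S \<in> tabloids ?lam" for S
    proof -
      have "int ?n - k - 1 = int ?n + (- (k + 1))" "int ?n - k - 1 + 1 = int ?n + (- k)"
        by simp_all
      then have "res ?n (int ?n - k - 1) = res ?n (- (k + 1))"
        "res ?n (int ?n - k - 1 + 1) = res ?n (- k)"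
        by (simp_all only: res_add_modulus)
      then show "res ?n (int ?n - k - 1) \<in> Des ?n (?U S) \<longleftrightarrow> res ?n (k + 1) \<in> Des ?n S"
        "res ?n (int ?n - k - 1 + 1) \<in> Des ?n (?U S) \<longleftrightarrow> res ?n k \<in> Des ?n S"
        using Des_upside_down[OF that, of "- (k + 1)"] Des_upside_down[OF that, of "- k"]
        unfolding sum minus_minus by (simp_all only:)
    qed
    have "knuth_move ?n (?U T) (?U T')"
      using move T k by (auto simp: knuth_move_of_type_def)
    then show ?thesis
      using k unfolding knuth_move_of_type_def Diff_iff D[OF T(1)] D[OF T(2)] by blast
  qed
  show ?thesis
    unfolding is_affine_evacuation_def
  proof (intro conjI allI ballI impI)
    fix k
    have "RRSS ?lam k \<in> tabloids ?lam" by (rule RRSS_in_tabloids) (simp only: sum assms)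
    then show "restrict ?U (tabloids ?lam) (RRSS ?lam k) = RRSS ?lam (int (sum_list ?lam) - k)"
      by (simp only: restrict_apply' upside_down_RRSS sum)
  next
    fix k T T'
    assume "T \<in> tabloids ?lam" "T' \<in> tabloids ?lam" "knuth_move_of_type (sum_list ?lam) k T T'"
    then show "knuth_move_of_type (sum_list ?lam) (int (sum_list ?lam) - k - 1)
       (restrict ?U (tabloids ?lam) T) (restrict ?U (tabloids ?lam) T')"
      using type by (simp only: restrict_apply' sum)
  qed (simp_all add: automorphism)
qed

section \<open>The description of affine evacuation on rectangles\<close>

theorem proposition3p10:
  fixes a b :: nat and T :: tabloid and t :: "nat \<Rightarrow> nat \<Rightarrow> int"
  assumes "a \<ge> 1" and "b \<ge> 1"
    and "T \<in> tabloids (replicate b a)"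
    and "\<forall>i \<in> {1..b}. T ! (i - 1) = {res (a * b) (t i j) | j. j \<in> {1..a}}"
  shows "affine_evacuation (replicate b a) T \<in> tabloids (replicate b a) \<and>
    (\<forall>i \<in> {1..b}. affine_evacuation (replicate b a) T ! (i - 1) =
       {res (a * b) (int (a * b) + 1 - t (b + 1 - i) j) | j. j \<in> {1..a}}) \<and>
    affine_evacuation (replicate b a) T =
      map (\<lambda>R. (\<lambda>x. res (a * b) (int (a * b) + 1 - x)) ` R) (rev T)"
proof -
  let ?lam = "replicate b a"
  have "is_affine_evacuation ?lam (restrict (upside_down (b * a)) (tabloids ?lam))"
    using assms(1,2) by (intro upside_down_is_affine_evacuation) simp
  then have "affine_evacuation ?lam = restrict (upside_down (b * a)) (tabloids ?lam)"
    unfolding affine_evacuation_def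
    by (intro the_equality) (auto intro: affine_evacuation_unique)
  then have e: "affine_evacuation ?lam T = upside_down (a * b) T"
    using assms(3) by (simp add: mult.commute)
  have "length T = b"
    using assms(3) by (auto simp: tabloids_def row_sets_def)
  then have "upside_down (a * b) T ! (i - 1) =
      {res (a * b) (int (a * b) + 1 - t (b + 1 - i) j) | j. j \<in> {1..a}}" if i: "i \<in> {1..b}" for i
  proof -
    have i': "b + 1 - i \<in> {1..b}" and row: "b - Suc (i - 1) = b + 1 - i - 1" using i by auto
    have "T ! (b - Suc (i - 1)) = {res (a * b) (t (b + 1 - i) j) | j. j \<in> {1..a}}"
      unfolding row by (rule bspec[OF assms(4) i'])
    moreover have "upside_down (a * b) T ! (i - 1) =
        (\<lambda>x. res (a * b) (int (a * b) + 1 - x)) ` (T ! (b - Suc (i - 1)))"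
      using i \<open>length T = b\<close> by (auto simp: upside_down_def rev_nth)
    ultimately show ?thesis
      by (simp only: Setcompr_eq_image image_image res_reflect)
  qed
  moreover have "upside_down (a * b) T \<in> tabloids ?lam"
    using upside_down_in_tabloids[OF assms(3)] by (simp add: mult.commute)
  ultimately show ?thesis
    unfolding e by (auto simp: upside_down_def)
qed

end
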